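(* Fix a family of hypergraphs $\mathcal H$ with finitely many members. If $\mathcal H$ contains (as a member) a $q$-sunflower with sets of equal size, then $f(m,\mathcal H)\le q-1$. Otherwise, $f(m,\mathcal H)\to\infty$ as $m\to\infty$.
   Context: A hypergraph $H$ on a finite vertex set $V(H)$ is a subset of $2^{V(H)}$; its elements are its edges, $|F|$ denotes the number of edges of $F$, and a subgraph of $F$ is given by a subset of its edges. For a family $\mathcal H$ of hypergraphs, a hypergraph $F$ is $\mathcal H$-free if it contains no copy of any member of $\mathcal H$ as a (not necessarily induced) subgraph. Let $\mathrm{ex}(F,\mathcal H)$ be the maximum number of edges of an $\mathcal H$-free subgraph of $F$, and $$f(m,\mathcal H):=\min_{|F|=m}\mathrm{ex}(F,\mathcal H),$$ the minimum being over all hypergraphs $F$ with $m$ edges (not necessarily uniform). A $q$-sunflower is a hypergraph $\{A_1,\dots,A_q\}$ such that $A_i\cap A_j=\bigcap_{s=1}^q A_s$ for all $i\ne j$.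
   Formalization: Every member of the family is assumed to have at least one edge (otherwise ex(F,H) can be undefined), and the hypergraph whose only edge is the empty set is not counted as a 1-sunflower, since for it the bound f(m) ≤ q-1 = 0 fails for m ≥ 2. *)

theory Defs
  imports Complex_Main
begin

datatype 'a hypergraph = Hypergraph (verts: "'a set") (edges: "'a set set")

definition hypergraph :: "'a hypergraph \<Rightarrow> bool" where
  "hypergraph F \<longleftrightarrow> finite (verts F) \<and> edges F \<subseteq> Pow (verts F)"

text \<open>A copy need not be induced. The vertex types may differ, and the vertices of the
  contained hypergraph that lie in no edge have to be embedded as well.\<close>

definition contains_copy :: "'b hypergraph \<Rightarrow> 'a hypergraph \<Rightarrow> bool" where
  "contains_copy F H \<longleftrightarrow>
     (\<exists>\<phi>. inj_on \<phi> (verts H) \<and> \<phi> ` verts H \<subseteq> verts F \<and> (\<forall>A\<in>edges H. \<phi> ` A \<in> edges F))"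

definition family_free :: "'a hypergraph set \<Rightarrow> 'b hypergraph \<Rightarrow> bool" where
  "family_free \<H> F \<longleftrightarrow> (\<forall>H\<in>\<H>. \<not> contains_copy F H)"

text \<open>Subgraphs keep the vertex set and are given by a subset of the edges. If every member of
  the family has an edge, then the subgraph without edges is free, so the maximum exists.\<close>

definition ex_num :: "'b hypergraph \<Rightarrow> 'a hypergraph set \<Rightarrow> nat" where
  "ex_num F \<H> = Max {card E | E. E \<subseteq> edges F \<and> family_free \<H> (Hypergraph (verts F) E)}"

text \<open>Every finite hypergraph is isomorphic to one whose vertices are natural numbers. There are
  infinitely many such hypergraphs with \<open>m\<close> edges, but \<open>ex_num\<close> takes only values up to \<open>m\<close>
  on them, so the set below is finite (and nonempty).\<close>

definition min_ex :: "nat \<Rightarrow> 'a hypergraph set \<Rightarrow> nat" where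
  "min_ex m \<H> = Min {ex_num F \<H> | F :: nat hypergraph. hypergraph F \<and> card (edges F) = m}"

definition sunflower :: "nat \<Rightarrow> 'a hypergraph \<Rightarrow> bool" where
  "sunflower q H \<longleftrightarrow>
     (\<exists>A. bij_betw A {1..q} (edges H) \<and>
        (\<forall>i\<in>{1..q}. \<forall>j\<in>{1..q}. i \<noteq> j \<longrightarrow> A i \<inter> A j = (\<Inter>s\<in>{1..q}. A s)))"

definition equal_sized :: "'a hypergraph \<Rightarrow> bool" where
  "equal_sized H \<longleftrightarrow> (\<exists>k. \<forall>A\<in>edges H. card A = k)"

text \<open>The hypergraph whose only edge is the empty set is excluded: it is formally a 1-sunflower,
  but a hypergraph has at most one empty edge, so every hypergraph with \<open>m\<close> edges has a subgraph
  with at least \<open>m - 1\<close> edges that avoids it.\<close>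

definition equal_sized_sunflower :: "nat \<Rightarrow> 'a hypergraph \<Rightarrow> bool" where
  "equal_sized_sunflower q H \<longleftrightarrow> sunflower q H \<and> equal_sized H \<and> edges H \<noteq> {{}}"

end

theory Submission
  imports Defs
begin

text \<open>
  Upper bound: if the family contains a \<open>q\<close>-sunflower \<open>H\<close> whose edges all have the same positive
  size, let \<open>F\<close> be a sunflower with \<open>m\<close> petals, with the same kernel and petal sizes as \<open>H\<close>, and
  with as many spare vertices as \<open>H\<close> has vertices. Any \<open>q\<close> edges of \<open>F\<close>, together with the spare
  vertices, contain a copy of \<open>H\<close> (\<open>contains_copy_of_sunflower\<close>), so a free subgraph has fewer
  than \<open>q\<close> edges.

  Divergence: suppose that no member is such a sunflower, and let \<open>r\<close> bound the edge sizes of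
  all members. Given \<open>k \<ge> 2\<close> and a hypergraph \<open>F\<close> with very many edges, there are two cases. If
  \<open>k\<close> edges of \<open>F\<close> have more than \<open>r\<close> elements, these edges form a free subgraph, because
  embeddings preserve edge sizes. Otherwise almost all edges have size at most \<open>r\<close>, so very many
  have one common size, and the Erdos--Rado sunflower lemma (\<open>sunflower_lemma\<close>) yields \<open>k\<close> of
  them that form a sunflower. Everything contained in an equal-sized sunflower is again one, so
  these \<open>k\<close> edges form a free subgraph as well (\<open>copy_in_sunflower\<close>).
\<close>

section \<open>The sunflower lemma\<close>

text \<open>The library predicate \<^const>\<open>pairwise\<close> expresses that the edges in \<open>E\<close> form a sunflower
  with kernel \<open>K\<close>; for at most one edge the kernel is arbitrary.\<close>

abbreviation has_kernel :: "'a set \<Rightarrow> 'a set set \<Rightarrow> bool" where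
  "has_kernel K E \<equiv> pairwise (\<lambda>A B. A \<inter> B = K) E"

lemma ex_maximal_disjoint_subfamily:
  assumes "finite F" and "{} \<notin> F"
  obtains D where "D \<subseteq> F" and "has_kernel {} D" and "\<And>A. A \<in> F \<Longrightarrow> A \<inter> \<Union>D \<noteq> {}"
proof -
  let ?S = "{D. D \<subseteq> F \<and> has_kernel {} D}"
  have "finite ?S" using assms(1) by simp
  moreover have "{} \<in> ?S" by simp
  ultimately obtain D where D: "D \<in> ?S" and max: "\<And>D'. D' \<in> ?S \<Longrightarrow> D \<subseteq> D' \<Longrightarrow> D = D'"
    using finite_has_maximal[of ?S] by (metis (no_types, lifting) empty_iff)
  show thesis
  proof
    show "D \<subseteq> F" "has_kernel {} D" using D by auto
    fix A assume A: "A \<in> F"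
    show "A \<inter> \<Union>D \<noteq> {}"
    proof
      assume disj: "A \<inter> \<Union>D = {}"
      then have "insert A D \<in> ?S"
        using D A by (auto simp: pairwise_insert)
      then have "A \<in> D" using max by blast
      then have "A = {}" using disj Union_upper[of A D] by (simp add: Int_absorb2)
      then show False using A assms(2) by simp
    qed
  qed
qed

text \<open>Induction on the edge size. If a maximal disjoint subfamily has fewer than \<open>k\<close> members, its
  union is small and meets every edge, so some vertex \<open>x\<close> lies in many edges. A sunflower found
  among these edges with \<open>x\<close> deleted becomes a sunflower in \<open>F\<close> when \<open>x\<close> is put back into its
  kernel.\<close>

lemma sunflower_lemma:
  fixes F :: "'a set set"
  assumes "\<And>A. A \<in> F \<Longrightarrow> finite A \<and> card A = s"
    and "card F > fact s * (k - 1) ^ s"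
  shows "\<exists>E K. E \<subseteq> F \<and> card E = k \<and> has_kernel K E"
  using assms
proof (induction s arbitrary: F)
  case 0
  then have "F \<subseteq> {{}}" using card_0_eq by blast
  then have "card F \<le> card {{} :: 'a set}" by (intro card_mono) auto
  then show ?case using 0 by simp
next
  case (Suc s)
  have finF: "finite F" using Suc.prems(2) by (metis card.infinite not_less_zero)
  have "{} \<notin> F" using Suc.prems(1) by fastforce
  then obtain D where D: "D \<subseteq> F" "has_kernel {} D" "\<And>A. A \<in> F \<Longrightarrow> A \<inter> \<Union>D \<noteq> {}"
    using ex_maximal_disjoint_subfamily[OF finF] by blast
  have finD: "finite D" using D(1) finF by (rule finite_subset)
  show ?case
  proof (cases "k \<le> card D")
    case True
    then obtain E where E: "E \<subseteq> D" "card E = k" by (meson obtain_subset_with_card_n)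
    then show ?thesis using D(1) pairwise_subset[OF D(2) E(1)] by blast
  next
    case False
    let ?star = "\<lambda>x. {A \<in> F. x \<in> A}"
    have finU: "finite (\<Union>D)" using finD D(1) Suc.prems(1) by blast
    have "card (\<Union>D) \<le> (\<Sum>A\<in>D. card A)" by (rule card_Union_le_sum_card)
    also have "\<dots> = card D * Suc s" using D(1) Suc.prems(1) by (simp add: subset_iff)
    also have "\<dots> \<le> (k - 1) * Suc s" using False by (intro mult_right_mono) auto
    finally have cardU: "card (\<Union>D) \<le> (k - 1) * Suc s" .
    have "\<exists>x\<in>\<Union>D. card (?star x) > fact s * (k - 1) ^ s"
    proof (rule ccontr)
      assume "\<not> ?thesis"
      then have le: "\<And>x. x \<in> \<Union>D \<Longrightarrow> card (?star x) \<le> fact s * (k - 1) ^ s"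
        by (meson not_less)
      have "F = (\<Union>x\<in>\<Union>D. ?star x)" using D(3) by blast
      then have "card F \<le> (\<Sum>x\<in>\<Union>D. card (?star x))"
        using card_UN_le[OF finU, of ?star] by simp
      also have "\<dots> \<le> card (\<Union>D) * (fact s * (k - 1) ^ s)"
        using sum_bounded_above[of "\<Union>D", OF le] by simp
      also have "\<dots> \<le> (k - 1) * Suc s * (fact s * (k - 1) ^ s)"
        using cardU by (rule mult_right_mono) simp
      also have "\<dots> = fact (Suc s) * (k - 1) ^ Suc s" by (simp add: algebra_simps)
      finally show False using Suc.prems(2) by simp
    qed
    then obtain x where x: "card (?star x) > fact s * (k - 1) ^ s" by blast
    let ?G = "(\<lambda>A. A - {x}) ` ?star x"
    have "inj_on (\<lambda>A. A - {x}) (?star x)" by (rule inj_onI) blast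
    then have "card ?G = card (?star x)" by (rule card_image)
    moreover have "finite A \<and> card A = s" if "A \<in> ?G" for A
      using that Suc.prems(1) by fastforce
    ultimately obtain E K where E: "E \<subseteq> ?G" "card E = k" "has_kernel K E"
      using Suc.IH[of ?G] x by auto
    have notin: "x \<notin> A" if "A \<in> E" for A using that E(1) by blast
    have "insert x ` E \<subseteq> F"
    proof
      fix B assume "B \<in> insert x ` E"
      then obtain A where "A \<in> F" "x \<in> A" "B = insert x (A - {x})" using E(1) by blast
      then show "B \<in> F" by (simp add: insert_absorb)
    qed
    moreover have "inj_on (insert x) E" by (rule inj_onI) (metis notin insert_ident)
    then have "card (insert x ` E) = k" using E(2) by (simp add: card_image)
    moreover have "has_kernel (insert x K) (insert x ` E)"
    proof (rule pairwiseI)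
      fix B C assume "B \<in> insert x ` E" "C \<in> insert x ` E" "B \<noteq> C"
      then obtain B' C' where BC: "B' \<in> E" "C' \<in> E" "B = insert x B'" "C = insert x C'"
        by blast
      then have "B' \<inter> C' = K" using pairwiseD[OF E(3), of B' C'] \<open>B \<noteq> C\<close> by blast
      then show "B \<inter> C = insert x K" using BC by blast
    qed
    ultimately show ?thesis by blast
  qed
qed

section \<open>Sunflowers and their kernels\<close>

lemma sunflower_if_has_kernel:
  assumes fin: "finite (edges H)" and K: "has_kernel K (edges H)"
  shows "sunflower (card (edges H)) H"
proof -
  let ?q = "card (edges H)"
  obtain A where A: "bij_betw A {1..?q} (edges H)"
    using ex_bij_betw_nat_finite_1[OF fin] by blast
  have inter: "A i \<inter> A j = K" if "i \<in> {1..?q}" "j \<in> {1..?q}" "i \<noteq> j" for i j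
    using pairwiseD[OF K, of "A i" "A j"] bij_betw_apply[OF A] bij_betw_imp_inj_on[OF A] that
    by (metis inj_onD)
  have "A i \<inter> A j = (\<Inter>s\<in>{1..?q}. A s)" if ij: "i \<in> {1..?q}" "j \<in> {1..?q}" "i \<noteq> j" for i j
  proof
    show "(\<Inter>s\<in>{1..?q}. A s) \<subseteq> A i \<inter> A j" using ij by blast
    have "K \<subseteq> A s" if "s \<in> {1..?q}" for s
      using inter[of s i] inter[of s j] ij that by (cases "s = i") auto
    then show "A i \<inter> A j \<subseteq> (\<Inter>s\<in>{1..?q}. A s)" using inter[OF ij] by blast
  qed
  then show ?thesis unfolding sunflower_def using A by blast
qed

text \<open>Two distinct edges of equal finite size cannot be nested, so all petals are nonempty. A
  single edge counts as a sunflower with empty kernel, for which this needs the edge to be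
  nonempty.\<close>

lemma equal_sized_sunflower_kernel:
  assumes H: "hypergraph H" "edges H \<noteq> {}" and sf: "equal_sized_sunflower q H"
  obtains K k where "card (edges H) = q" and "has_kernel K (edges H)"
    and "\<And>A. A \<in> edges H \<Longrightarrow> K \<subseteq> A" and "\<And>A. A \<in> edges H \<Longrightarrow> card A = k" and "card K < k"
proof -
  have "sunflower q H" using sf by (simp add: equal_sized_sunflower_def)
  then obtain A where A: "bij_betw A {1..q} (edges H)"
    and inter: "\<forall>i\<in>{1..q}. \<forall>j\<in>{1..q}. i \<noteq> j \<longrightarrow> A i \<inter> A j = (\<Inter>s\<in>{1..q}. A s)"
    unfolding sunflower_def by (elim exE conjE)
  obtain k where k: "\<And>B. B \<in> edges H \<Longrightarrow> card B = k"
    using sf unfolding equal_sized_sunflower_def equal_sized_def by blast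
  have q: "card (edges H) = q" using bij_betw_same_card[OF A] by simp
  have fin: "finite B" if "B \<in> edges H" for B
    using H(1) that unfolding hypergraph_def by (meson PowD finite_subset subsetD)
  obtain B where B: "B \<in> edges H" using H(2) by blast
  show thesis
  proof (cases "edges H = {B}")
    case True
    then have "B \<noteq> {}" using sf unfolding equal_sized_sunflower_def by blast
    then have "card {} < k" using k[OF B] fin[OF B] by (metis card.empty card_gt_0_iff)
    then show thesis using that[of "{}" k] q k True by simp
  next
    case False
    let ?K = "\<Inter>s\<in>{1..q}. A s"
    have img: "A ` {1..q} = edges H" using A by (simp add: bij_betw_def)
    have kern: "has_kernel ?K (edges H)"
      unfolding pairwise_def img[symmetric] ball_simps(9) using inter by metis
    have sub: "?K \<subseteq> C" if "C \<in> edges H" for C using that img by blast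
    obtain C where C: "C \<in> edges H" "C \<noteq> B" using False B by blast
    have "?K \<noteq> B"
    proof
      assume "?K = B"
      then have "B \<subseteq> C" using sub[OF C(1)] by simp
      then have "B = C" using card_subset_eq[OF fin[OF C(1)]] k B C(1) by simp
      then show False using C(2) by simp
    qed
    then have "card ?K < k" using psubset_card_mono[OF fin[OF B]] sub[OF B] k[OF B] by blast
    then show thesis using that[of ?K k] q kern sub k by blast
  qed
qed

section \<open>Extremal numbers\<close>

lemma not_contains_copy_no_edges: "edges H \<noteq> {} \<Longrightarrow> \<not> contains_copy (Hypergraph V {}) H"
  unfolding contains_copy_def by auto

lemma finite_edges: "hypergraph F \<Longrightarrow> finite (edges F)"
  unfolding hypergraph_def by (meson finite_Pow_iff finite_subset)

lemma finite_free_sizes: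
  assumes "hypergraph F"
  shows "finite {card E | E. E \<subseteq> edges F \<and> P E}"
  using finite_edges[OF assms] by simp

lemma le_ex_num:
  assumes "hypergraph F" "E \<subseteq> edges F" "family_free \<H> (Hypergraph (verts F) E)"
  shows "card E \<le> ex_num F \<H>"
  unfolding ex_num_def using assms by (intro Max_ge finite_free_sizes) auto

lemma ex_num_attained:
  assumes "hypergraph F" "\<And>H. H \<in> \<H> \<Longrightarrow> edges H \<noteq> {}"
  obtains E where "E \<subseteq> edges F" "family_free \<H> (Hypergraph (verts F) E)" "card E = ex_num F \<H>"
proof -
  let ?S = "{card E | E. E \<subseteq> edges F \<and> family_free \<H> (Hypergraph (verts F) E)}"
  have "family_free \<H> (Hypergraph (verts F) {})"
    using assms(2) not_contains_copy_no_edges unfolding family_free_def by blast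
  then have "?S \<noteq> {}" by blast
  then have "Max ?S \<in> ?S" using finite_free_sizes[OF assms(1)] by (intro Max_in) auto
  then show thesis using that unfolding ex_num_def by auto
qed

lemma ex_num_le_card_edges:
  assumes "hypergraph F" "\<And>H. H \<in> \<H> \<Longrightarrow> edges H \<noteq> {}"
  shows "ex_num F \<H> \<le> card (edges F)"
  by (metis assms card_mono ex_num_attained finite_edges)

lemma finite_ex_nums:
  assumes "\<And>H. H \<in> \<H> \<Longrightarrow> edges H \<noteq> {}"
  shows "finite {ex_num F \<H> | F :: nat hypergraph. hypergraph F \<and> card (edges F) = m}"
  using ex_num_le_card_edges[OF _ assms]
  by (intro finite_subset[OF _ finite_atMost[of m]]) auto

lemma min_ex_attained:
  assumes "\<And>H. H \<in> \<H> \<Longrightarrow> edges H \<noteq> {}"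
  obtains F :: "nat hypergraph"
  where "hypergraph F" "card (edges F) = m" "min_ex m \<H> = ex_num F \<H>"
proof -
  let ?S = "{ex_num F \<H> | F :: nat hypergraph. hypergraph F \<and> card (edges F) = m}"
  \<comment> \<open>The singletons witness that there is a hypergraph with \<open>m\<close> edges.\<close>
  let ?F = "Hypergraph {..<m} ((\<lambda>i. {i}) ` {..<m})"
  have "hypergraph ?F" "card (edges ?F) = m"
    unfolding hypergraph_def by (auto simp: card_image inj_on_def)
  then have "ex_num ?F \<H> \<in> ?S" by blast
  then have "Min ?S \<in> ?S" using finite_ex_nums[OF assms] by (intro Min_in) auto
  then show thesis using that unfolding min_ex_def by auto
qed

section \<open>Every large sunflower contains every small one of the same shape\<close>

definition big_edge :: "nat \<Rightarrow> nat \<Rightarrow> nat \<Rightarrow> nat set" where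
  "big_edge c p i = {..<c} \<union> {c + i * p..<c + i * p + p}"

text \<open>The vertices from \<open>c + m * p\<close> on lie in no edge; they leave room for \<open>n\<close> isolated
  vertices.\<close>

definition big_sunflower :: "nat \<Rightarrow> nat \<Rightarrow> nat \<Rightarrow> nat \<Rightarrow> nat hypergraph" where
  "big_sunflower c p m n = Hypergraph {..<c + m * p + n} (big_edge c p ` {..<m})"

lemma interval_index_unique:
  fixes i j p x :: nat
  assumes "x \<in> {c + i * p..<c + i * p + p}" "x \<in> {c + j * p..<c + j * p + p}"
  shows "i = j"
proof -
  have "(x - c) div p = l" if "x \<in> {c + l * p..<c + l * p + p}" for l
    using that by (intro div_nat_eqI) (auto simp: algebra_simps)
  then show ?thesis using assms by metis
qed

lemma inj_big_edge:
  assumes "0 < p"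
  shows "inj (big_edge c p)"
proof (rule injI)
  fix i j assume "big_edge c p i = big_edge c p j"
  moreover have "c + i * p \<in> big_edge c p i" using assms by (simp add: big_edge_def)
  ultimately have "c + i * p \<in> {c + j * p..<c + j * p + p}" by (auto simp: big_edge_def)
  then show "i = j" using interval_index_unique[of "c + i * p" c i p j] assms by simp
qed

lemma petal_below:
  fixes p :: nat
  assumes "i < m" "x \<in> {c + i * p..<c + i * p + p}"
  shows "x < c + m * p"
proof -
  have "Suc i * p \<le> m * p" using assms(1) by (intro mult_right_mono) auto
  then show ?thesis using assms(2) by simp
qed

lemma hypergraph_big_sunflower: "hypergraph (big_sunflower c p m n)"
proof -
  have "big_edge c p i \<subseteq> {..<c + m * p + n}" if "i < m" for i
    using petal_below[OF that, of _ c p] by (fastforce simp: big_edge_def)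
  then show ?thesis unfolding hypergraph_def big_sunflower_def by auto
qed

lemma card_edges_big_sunflower: "0 < p \<Longrightarrow> card (edges (big_sunflower c p m n)) = m"
  unfolding big_sunflower_def
  by (simp add: card_image[OF inj_on_subset[OF inj_big_edge subset_UNIV]])

text \<open>The embedding sends kernel to kernel, the petals of \<open>H\<close> to distinct petals that occur in
  \<open>E\<close>, and the isolated vertices of \<open>H\<close> to spare vertices. It is glued from bijections between
  these disjoint pieces.\<close>

lemma contains_copy_of_sunflower:
  assumes H: "hypergraph H" and kern: "has_kernel K (edges H)"
    and sub: "\<And>A. A \<in> edges H \<Longrightarrow> K \<subseteq> A" and size: "\<And>A. A \<in> edges H \<Longrightarrow> card A = card K + p"
    and finK: "finite K"
    and E: "E \<subseteq> big_edge (card K) p ` {..<m}" and large: "card (edges H) \<le> card E"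
  shows "contains_copy (Hypergraph {..<card K + m * p + card (verts H)} E) H"
proof -
  let ?c = "card K"
  let ?petal = "\<lambda>i. {?c + i * p..<?c + i * p + p}"
  let ?rest = "{?c + m * p..<?c + m * p + card (verts H)}"
  have finV: "finite (verts H)" and subV: "\<And>A. A \<in> edges H \<Longrightarrow> A \<subseteq> verts H"
    using H unfolding hypergraph_def by auto
  have finA: "\<And>A. A \<in> edges H \<Longrightarrow> finite A" using subV finV by (meson finite_subset)
  obtain e where e: "inj_on e (edges H)" "e ` edges H \<subseteq> E"
    using card_le_inj[OF finite_edges[OF H] finite_subset[OF E] large] by auto
  have "\<forall>A\<in>edges H. \<exists>i. i < m \<and> e A = big_edge ?c p i" using e(2) E by blast
  then obtain g where g: "\<And>A. A \<in> edges H \<Longrightarrow> g A < m"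
    and eg: "\<And>A. A \<in> edges H \<Longrightarrow> e A = big_edge ?c p (g A)" by metis
  obtain fK where fK: "bij_betw fK K {..<?c}"
    using ex_bij_betw_finite_nat[OF finK] by (metis lessThan_atLeast0)
  have "\<exists>h. bij_betw h (A - K) (?petal (g A))" if "A \<in> edges H" for A
    using finA[OF that] sub[OF that] size[OF that]
    by (intro finite_same_card_bij) (auto simp: card_Diff_subset finK)
  then obtain h where h: "\<And>A. A \<in> edges H \<Longrightarrow> bij_betw (h A) (A - K) (?petal (g A))"
    by metis
  obtain fR where fR: "inj_on fR (verts H)" "fR ` verts H \<subseteq> ?rest"
    using card_le_inj[OF finV, of ?rest] by auto
  \<comment> \<open>Outside the kernel a vertex lies in at most one edge.\<close>
  have owner: "A = B" if "A \<in> edges H" "B \<in> edges H" "x \<in> A" "x \<in> B" "x \<notin> K" for A B x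
    using kern that unfolding pairwise_def by blast
  define \<phi> where "\<phi> x = (if x \<in> K then fK x else if x \<in> \<Union>(edges H)
    then h (THE A. A \<in> edges H \<and> x \<in> A) x else fR x)" for x
  have \<phi>K: "\<phi> x = fK x" if "x \<in> K" for x using that by (simp add: \<phi>_def)
  have \<phi>A: "\<phi> x = h A x" if "A \<in> edges H" "x \<in> A - K" for A x
  proof -
    have "(THE A. A \<in> edges H \<and> x \<in> A) = A" using that owner by (intro the_equality) blast+
    then show ?thesis using that by (auto simp: \<phi>_def)
  qed
  have \<phi>R: "\<phi> x = fR x" if "x \<notin> K" "x \<notin> \<Union>(edges H)" for x using that by (simp add: \<phi>_def)
  have inK: "fK x < ?c" if "x \<in> K" for x using fK that by (auto simp: bij_betw_def)
  have inA: "h A x \<in> ?petal (g A)" if "A \<in> edges H" "x \<in> A - K" for A x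
    using h that by (meson bij_betwE)
  have inR: "fR x \<in> ?rest" if "x \<in> verts H" for x using fR(2) that by blast
  have img: "\<phi> ` A = e A" if A: "A \<in> edges H" for A
  proof -
    have "\<phi> ` A = \<phi> ` K \<union> \<phi> ` (A - K)" using sub[OF A] by blast
    also have "\<phi> ` K = {..<?c}" using \<phi>K fK by (simp add: bij_betw_def)
    also have "\<phi> ` (A - K) = ?petal (g A)"
      using \<phi>A[OF A] bij_betw_imp_surj_on[OF h[OF A]] image_cong[OF refl, of "A - K" \<phi> "h A"]
      by simp
    finally show ?thesis using eg[OF A] by (simp add: big_edge_def)
  qed
  \<comment> \<open>The index of the image piece determines the piece from which a vertex comes.\<close>
  have pieces: "x \<in> K \<and> \<phi> x < ?c \<or> (\<exists>A\<in>edges H. x \<in> A - K \<and> \<phi> x \<in> ?petal (g A))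
      \<or> x \<notin> K \<and> x \<notin> \<Union>(edges H) \<and> \<phi> x \<in> ?rest" if "x \<in> verts H" for x
    using inK[of x] \<phi>K[of x] inA[of _ x] \<phi>A[of _ x] inR[OF that] \<phi>R[of x] by (metis DiffI UnionE)
  have below: "y < ?c + m * p" if "A \<in> edges H" "y \<in> ?petal (g A)" for A y
    using petal_below[OF g] that by blast
  have g_inj: "A = B" if "A \<in> edges H" "B \<in> edges H" "g A = g B" for A B
    using e(1) eg that by (metis inj_onD)
  have "inj_on \<phi> (verts H)"
  proof (rule inj_onI)
    fix x y assume x: "x \<in> verts H" and y: "y \<in> verts H" and eq: "\<phi> x = \<phi> y"
    consider "x \<in> K" "\<phi> x < ?c" | A where "A \<in> edges H" "x \<in> A - K" "\<phi> x \<in> ?petal (g A)"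
      | "x \<notin> K" "x \<notin> \<Union>(edges H)" "\<phi> x \<in> ?rest" using pieces[OF x] by blast
    then show "x = y"
    proof cases
      case 1
      then have "y \<in> K" using pieces[OF y] eq by auto
      then show ?thesis using 1 fK eq by (simp add: \<phi>K bij_betw_def inj_on_def)
    next
      case (2 A)
      have "\<not> \<phi> y < ?c" "\<phi> y \<notin> ?rest" using 2 below[of A "\<phi> x"] eq by auto
      then obtain B where B: "B \<in> edges H" "y \<in> B - K" "\<phi> y \<in> ?petal (g B)"
        using pieces[OF y] by blast
      then have "A = B" using 2 eq interval_index_unique[of "\<phi> x" ?c "g A" p "g B"] g_inj by simp
      then show ?thesis using 2 B h[of A] eq \<phi>A by (metis bij_betw_def inj_onD)
    next
      case 3
      then have "y \<notin> K" "y \<notin> \<Union>(edges H)"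
        using pieces[OF y] eq below[of _ "\<phi> y"] by (auto dest: leD)
      then show ?thesis using 3 fR(1) eq x y by (simp add: \<phi>R inj_on_def)
    qed
  qed
  moreover have "\<phi> ` verts H \<subseteq> {..<?c + m * p + card (verts H)}"
  proof
    fix y assume "y \<in> \<phi> ` verts H"
    then obtain x where "x \<in> verts H" "y = \<phi> x" by blast
    then show "y \<in> {..<?c + m * p + card (verts H)}"
      using pieces[of x] below[of _ y] by fastforce
  qed
  ultimately show ?thesis
    unfolding contains_copy_def using img e(2) by (intro exI[of _ \<phi>]) auto
qed

lemma min_ex_less_sunflower:
  assumes hyp: "\<And>H. H \<in> \<H> \<Longrightarrow> hypergraph H" and ne: "\<And>H. H \<in> \<H> \<Longrightarrow> edges H \<noteq> {}"
    and H: "H \<in> \<H>" and sf: "equal_sized_sunflower q H"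
  shows "min_ex m \<H> < q"
proof -
  obtain K k where q: "card (edges H) = q" and kern: "has_kernel K (edges H)"
    and sub: "\<And>A. A \<in> edges H \<Longrightarrow> K \<subseteq> A" and k: "\<And>A. A \<in> edges H \<Longrightarrow> card A = k"
    and less: "card K < k"
    using equal_sized_sunflower_kernel[OF hyp[OF H] ne[OF H] sf] by blast
  let ?p = "k - card K"
  let ?F = "big_sunflower (card K) ?p m (card (verts H))"
  have F: "hypergraph ?F" by (rule hypergraph_big_sunflower)
  have finK: "finite K"
    using sub ne[OF H] hyp[OF H] unfolding hypergraph_def
    by (metis Pow_iff all_not_in_conv finite_subset subsetD)
  have "ex_num ?F \<H> < q"
  proof -
    obtain E where E: "E \<subseteq> edges ?F" "family_free \<H> (Hypergraph (verts ?F) E)"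
      and card: "card E = ex_num ?F \<H>"
      using ex_num_attained[OF F, of \<H>] ne by blast
    have "\<not> card (edges H) \<le> card E"
      using contains_copy_of_sunflower[OF hyp[OF H] kern sub, of ?p E m] k less finK E H
      unfolding family_free_def big_sunflower_def by auto
    then show ?thesis using card q by simp
  qed
  moreover have "min_ex m \<H> \<le> ex_num ?F \<H>"
    unfolding min_ex_def using F less card_edges_big_sunflower[of ?p "card K" m]
    by (intro Min_le finite_ex_nums ne) auto
  ultimately show ?thesis by simp
qed

section \<open>Free subgraphs of hypergraphs with many edges\<close>

text \<open>Sizes and intersections of edges are preserved by an embedding, so they can be read off in
  the ambient sunflower.\<close>

lemma copy_in_sunflower:
  assumes H: "hypergraph H" and copy: "contains_copy F H" and K: "has_kernel K (edges F)"
    and size: "\<And>A. A \<in> edges F \<Longrightarrow> card A = s" and pos: "0 < s"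
  shows "equal_sized_sunflower (card (edges H)) H"
proof -
  obtain \<phi> where \<phi>: "inj_on \<phi> (verts H)" and img: "\<And>A. A \<in> edges H \<Longrightarrow> \<phi> ` A \<in> edges F"
    using copy unfolding contains_copy_def by blast
  have sub: "A \<subseteq> verts H" if "A \<in> edges H" for A using H that unfolding hypergraph_def by blast
  have card: "card A = s" if "A \<in> edges H" for A
    using size[OF img[OF that]] card_image[OF inj_on_subset[OF \<phi> sub[OF that]]] by simp
  have "has_kernel {x \<in> verts H. \<phi> x \<in> K} (edges H)"
  proof (rule pairwiseI)
    fix A B assume AB: "A \<in> edges H" "B \<in> edges H" "A \<noteq> B"
    have "\<phi> ` A \<noteq> \<phi> ` B" using AB sub \<phi> by (simp add: inj_on_image_eq_iff)
    then have "\<phi> ` A \<inter> \<phi> ` B = K" using pairwiseD[OF K img img] AB by simp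
    then have "\<phi> ` (A \<inter> B) = K" using AB sub inj_on_image_Int[OF \<phi>] by simp
    then show "A \<inter> B = {x \<in> verts H. \<phi> x \<in> K}"
      using AB sub \<phi> unfolding inj_on_def by blast
  qed
  then have "sunflower (card (edges H)) H" by (rule sunflower_if_has_kernel[OF finite_edges[OF H]])
  moreover have "edges H \<noteq> {{}}" using card[of "{}"] pos by auto
  ultimately show ?thesis
    unfolding equal_sized_sunflower_def equal_sized_def using card by blast
qed

lemma has_kernel_size_pos:
  assumes "has_kernel K E" "card E \<ge> 2" "\<And>A. A \<in> E \<Longrightarrow> finite A \<and> card A = s"
  shows "0 < s"
proof (rule ccontr)
  assume "\<not> 0 < s"
  then have "E \<subseteq> {{}}" using assms(3) card_0_eq by blast
  then show False using card_mono[of "{{}}" E] assms(2) by simp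
qed

text \<open>If neither alternative held, fewer than \<open>k\<close> edges would be larger than \<open>r\<close>, and for each
  \<open>s \<le> r\<close> the number of edges of size \<open>s\<close> would not exceed the threshold of the sunflower lemma.
  The assumed number of edges is the sum of these bounds.\<close>

lemma large_edges_or_sunflower:
  assumes F: "hypergraph F" and many: "card (edges F) \<ge> k + (\<Sum>s\<le>r. fact s * (k - 1) ^ s)"
  shows "\<exists>E \<subseteq> edges F. card E = k \<and>
    ((\<forall>A\<in>E. r < card A) \<or> (\<exists>K s. has_kernel K E \<and> (\<forall>A\<in>E. card A = s)))"
proof -
  let ?L = "{A \<in> edges F. r < card A}"
  let ?S = "\<lambda>s. {A \<in> edges F. card A = s}"
  have fin: "finite A" if "A \<in> edges F" for A
    using F that unfolding hypergraph_def by (meson PowD finite_subset subsetD)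
  show ?thesis
  proof (cases "k \<le> card ?L")
    case True
    then obtain E where "E \<subseteq> ?L" "card E = k" by (meson obtain_subset_with_card_n)
    then show ?thesis by (intro exI[of _ E]) auto
  next
    case False
    have "\<exists>s\<le>r. card (?S s) > fact s * (k - 1) ^ s"
    proof (rule ccontr)
      assume "\<not> ?thesis"
      then have le: "\<And>s. s \<in> {..r} \<Longrightarrow> card (?S s) \<le> fact s * (k - 1) ^ s"
        by (meson atMost_iff not_less)
      have "edges F = ?L \<union> (\<Union>s\<le>r. ?S s)" by auto
      then have "card (edges F) \<le> card ?L + card (\<Union>s\<le>r. ?S s)"
        using card_Un_le[of ?L "\<Union>s\<le>r. ?S s"] by simp
      also have "\<dots> \<le> card ?L + (\<Sum>s\<le>r. card (?S s))" by (simp add: card_UN_le)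
      also have "\<dots> < k + (\<Sum>s\<le>r. fact s * (k - 1) ^ s)"
        using False by (intro add_less_le_mono sum_mono le) auto
      finally show False using many by simp
    qed
    then obtain s where "card (?S s) > fact s * (k - 1) ^ s" by blast
    then obtain E K where "E \<subseteq> ?S s" "card E = k" "has_kernel K E"
      using sunflower_lemma[of "?S s" s k] fin by auto
    then show ?thesis by (intro exI[of _ E]) auto
  qed
qed

lemma min_ex_ge:
  assumes hyp: "\<And>H. H \<in> \<H> \<Longrightarrow> hypergraph H" and ne: "\<And>H. H \<in> \<H> \<Longrightarrow> edges H \<noteq> {}"
    and no_sf: "\<And>H q. H \<in> \<H> \<Longrightarrow> \<not> equal_sized_sunflower q H"
    and r: "\<And>H A. H \<in> \<H> \<Longrightarrow> A \<in> edges H \<Longrightarrow> card A \<le> r"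
    and k: "2 \<le> k" and m: "k + (\<Sum>s\<le>r. fact s * (k - 1) ^ s) \<le> m"
  shows "k \<le> min_ex m \<H>"
proof -
  obtain F :: "nat hypergraph"
    where F: "hypergraph F" "card (edges F) = m" and min: "min_ex m \<H> = ex_num F \<H>"
    using min_ex_attained[of \<H> m] ne by blast
  obtain E where E: "E \<subseteq> edges F" "card E = k"
    and alt: "(\<forall>A\<in>E. r < card A) \<or> (\<exists>K s. has_kernel K E \<and> (\<forall>A\<in>E. card A = s))"
    using large_edges_or_sunflower[OF F(1), of k r] m F(2) by auto
  have fin: "finite A" if "A \<in> E" for A
    using F(1) that E(1) unfolding hypergraph_def by (meson PowD finite_subset subsetD)
  have "\<not> contains_copy (Hypergraph (verts F) E) H" if H: "H \<in> \<H>" for H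
  proof
    assume copy: "contains_copy (Hypergraph (verts F) E) H"
    from alt show False
    proof
      assume large: "\<forall>A\<in>E. r < card A"
      obtain \<phi> where \<phi>: "inj_on \<phi> (verts H)" "\<forall>A\<in>edges H. \<phi> ` A \<in> E"
        using copy unfolding contains_copy_def by auto
      obtain A where A: "A \<in> edges H" using ne[OF H] by blast
      have "A \<subseteq> verts H" using hyp[OF H] A unfolding hypergraph_def by blast
      then have "card (\<phi> ` A) = card A" using \<phi>(1) by (meson card_image inj_on_subset)
      then show False using large \<phi>(2) A r[OF H A] by force
    next
      assume "\<exists>K s. has_kernel K E \<and> (\<forall>A\<in>E. card A = s)"
      then obtain K s where K: "has_kernel K E" and s: "\<forall>A\<in>E. card A = s" by blast
      have "0 < s" using has_kernel_size_pos[OF K] E(2) k s fin by blast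
      then have "equal_sized_sunflower (card (edges H)) H"
        using copy_in_sunflower[OF hyp[OF H] copy, of K s] K s by simp
      then show False using no_sf[OF H] by blast
    qed
  qed
  then have "card E \<le> ex_num F \<H>"
    using F(1) E(1) by (intro le_ex_num) (auto simp: family_free_def)
  then show ?thesis using min E(2) by simp
qed

section \<open>The dichotomy\<close>

theorem theorem2p1:
  fixes \<H> :: "'a hypergraph set"
  assumes "finite \<H>"
    and "\<And>H. H \<in> \<H> \<Longrightarrow> hypergraph H"
    and "\<And>H. H \<in> \<H> \<Longrightarrow> edges H \<noteq> {}"
  shows "(\<forall>q. (\<exists>H\<in>\<H>. equal_sized_sunflower q H) \<longrightarrow> (\<forall>m. int (min_ex m \<H>) \<le> int q - 1)) \<and>
    ((\<nexists>q. \<exists>H\<in>\<H>. equal_sized_sunflower q H) \<longrightarrow>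
      filterlim (\<lambda>m. min_ex m \<H>) at_top sequentially)"
proof (intro conjI allI impI)
  fix q m assume "\<exists>H\<in>\<H>. equal_sized_sunflower q H"
  then have "min_ex m \<H> < q" using min_ex_less_sunflower[OF assms(2,3)] by blast
  then show "int (min_ex m \<H>) \<le> int q - 1" by simp
next
  assume "\<nexists>q. \<exists>H\<in>\<H>. equal_sized_sunflower q H"
  then have no_sf: "\<And>H q. H \<in> \<H> \<Longrightarrow> \<not> equal_sized_sunflower q H" by blast
  have "finite (\<Union>H\<in>\<H>. card ` edges H)" using assms(1,2) finite_edges by blast
  then obtain r where "\<forall>n \<in> (\<Union>H\<in>\<H>. card ` edges H). n \<le> r"
    by (meson finite_nat_set_iff_bounded_le)
  then have r: "\<And>H A. H \<in> \<H> \<Longrightarrow> A \<in> edges H \<Longrightarrow> card A \<le> r" by blast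
  show "filterlim (\<lambda>m. min_ex m \<H>) at_top sequentially"
    unfolding filterlim_at_top
  proof
    fix Z :: nat
    \<comment> \<open>The detour to at least two edges excludes the sunflower that consists of the empty edge.\<close>
    define k where "k = max 2 Z"
    have "Z \<le> min_ex m \<H>" if "m \<ge> k + (\<Sum>s\<le>r. fact s * (k - 1) ^ s)" for m
      using min_ex_ge[OF assms(2,3) no_sf r _ that] by (simp add: k_def)
    then show "\<forall>\<^sub>F m in sequentially. Z \<le> min_ex m \<H>"
      by (rule eventually_sequentiallyI)
  qed
qed

end
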